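(* Let $\langle A,\vee\rangle$ be a join-semilattice with a least element $0$, and let $I_1,I_2$ be subsemilattices of $A$. Then $A=I_1\oplus_0 I_2$ if and only if: (Abs) for all $x_1,y_1\in I_1$ and $z_2\in I_2$, $x_1\wedge(y_1\vee z_2)=x_1\wedge y_1$, and likewise with the roles of $I_1$ and $I_2$ interchanged; and (onto) $I_1\vee I_2=A$, i.e. every $x\in A$ can be written as $x=x_1\vee x_2$ with $x_1\in I_1$, $x_2\in I_2$. Moreover, if $A=I_1\oplus_0 I_2$, then $I_1$ and $I_2$ are (order) ideals of $A$, i.e. downward closed.
   Context: A join-semilattice $\langle A,\vee\rangle$ is a set with an idempotent, commutative, associative binary operation $\vee$, ordered by $a\le b$ iff $a\vee b=b$. The partial operation $a\wedge b$ denotes the infimum of $\{a,b\}$ when it exists. Convention: any equation $t_1=t_2$ involving $\wedge$ means "if either side exists, then the other also exists and they are equal". A subsemilattice is a subset closed under $\vee$. For fixed $c\in A$, $\phi_c(x_1,x_2,x)$ is the conjunction of: (dist) $x=(x\vee x_1)\wedge(x\vee x_2)$; (p1) $x_1=(x\vee x_1)\wedge(c\vee x_1)$; (p2) $x_2=(x\vee x_2)\wedge(c\vee x_2)$; (join) $x_1\vee x_2=x\vee c$. For subsemilattices $I_1,I_2$, $A=I_1\oplus_c I_2$ means all of the following hold: (Mod1) for all $x,y\in A$, $x_1\in I_1$, $x_2\in I_2$: if $x\vee c\ge x_1\vee x_2$ then $((x\vee x_1)\wedge(x\vee x_2))\vee y=(x\vee y\vee x_1)\wedge(x\vee y\vee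 x_2)$; (Mod2) for all $x,y\in A$, $x_1\in I_1$, $x_2\in I_2$: if $x\le x_1\vee x_2$ then $((x\vee x_i)\wedge(c\vee x_i))\vee y=(x\vee y\vee x_i)\wedge(c\vee y\vee x_i)$ for $i=1,2$; (Abs$_c$) for all $x_1,y_1\in I_1$, $z_2\in I_2$: $x_1\wedge(y_1\vee z_2)=x_1\wedge(y_1\vee c)$, and likewise with $I_1,I_2$ interchanged; (exi) for all $x_1\in I_1,x_2\in I_2$ there is $x\in A$ with $\phi_c(x_1,x_2,x)$; (onto$_c$) for all $x\in A$ there are $x_1\in I_1,x_2\in I_2$ with $\phi_c(x_1,x_2,x)$. Here $A=I_1\oplus_0 I_2$ is this notion with $c=0$. *)

theory Defs
  imports Main
begin

unbundle lattice_syntax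

text \<open>
  A join-semilattice \<open>A\<close> is a type of class \<^class>\<open>semilattice_sup\<close>; there \<open>a \<le> b\<close> is
  equivalent to \<open>a \<squnion> b = b\<close> (lemma \<open>le_iff_sup\<close>).
\<close>

definition is_infimum :: "'a::order \<Rightarrow> 'a \<Rightarrow> 'a \<Rightarrow> bool" where
  "is_infimum a b m \<longleftrightarrow> m \<le> a \<and> m \<le> b \<and> (\<forall>z. z \<le> a \<and> z \<le> b \<longrightarrow> z \<le> m)"

text \<open>
  The partial meet is option-valued, \<open>None\<close> meaning that the infimum does not exist. Hence \<open>=\<close>
  between option-valued terms is exactly the convention ``if either side exists, then so does the
  other, and they are equal''. A total term \<open>t\<close> enters such an equation as \<open>Some t\<close>.
\<close>

definition pmeet :: "'a::order \<Rightarrow> 'a \<Rightarrow> 'a option" (infixl "\<sqinter>\<^sub>p" 70) where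
  "a \<sqinter>\<^sub>p b = (if \<exists>m. is_infimum a b m then Some (THE m. is_infimum a b m) else None)"

text \<open>Join of a possibly undefined term with an element; it exists iff the term does.\<close>

definition pjoin :: "'a::semilattice_sup option \<Rightarrow> 'a \<Rightarrow> 'a option" (infixl "\<squnion>\<^sub>p" 65) where
  "t \<squnion>\<^sub>p y = map_option (\<lambda>m. m \<squnion> y) t"

definition subsemilattice :: "'a::semilattice_sup set \<Rightarrow> bool" where
  "subsemilattice I \<longleftrightarrow> (\<forall>x\<in>I. \<forall>y\<in>I. x \<squnion> y \<in> I)"

definition downward_closed :: "'a::order set \<Rightarrow> bool" where
  "downward_closed I \<longleftrightarrow> (\<forall>x\<in>I. \<forall>y. y \<le> x \<longrightarrow> y \<in> I)"

definition phi :: "'a::semilattice_sup \<Rightarrow> 'a \<Rightarrow> 'a \<Rightarrow> 'a \<Rightarrow> bool" where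
  "phi c x1 x2 x \<longleftrightarrow>
     Some x = (x \<squnion> x1) \<sqinter>\<^sub>p (x \<squnion> x2) \<and>
     Some x1 = (x \<squnion> x1) \<sqinter>\<^sub>p (c \<squnion> x1) \<and>
     Some x2 = (x \<squnion> x2) \<sqinter>\<^sub>p (c \<squnion> x2) \<and>
     x1 \<squnion> x2 = x \<squnion> c"

definition Mod1 :: "'a::semilattice_sup \<Rightarrow> 'a set \<Rightarrow> 'a set \<Rightarrow> bool" where
  "Mod1 c I1 I2 \<longleftrightarrow>
     (\<forall>x y. \<forall>x1\<in>I1. \<forall>x2\<in>I2. x \<squnion> c \<ge> x1 \<squnion> x2 \<longrightarrow>
        ((x \<squnion> x1) \<sqinter>\<^sub>p (x \<squnion> x2)) \<squnion>\<^sub>p y = (x \<squnion> y \<squnion> x1) \<sqinter>\<^sub>p (x \<squnion> y \<squnion> x2))"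

definition Mod2 :: "'a::semilattice_sup \<Rightarrow> 'a set \<Rightarrow> 'a set \<Rightarrow> bool" where
  "Mod2 c I1 I2 \<longleftrightarrow>
     (\<forall>x y. \<forall>x1\<in>I1. \<forall>x2\<in>I2. x \<le> x1 \<squnion> x2 \<longrightarrow>
        ((x \<squnion> x1) \<sqinter>\<^sub>p (c \<squnion> x1)) \<squnion>\<^sub>p y = (x \<squnion> y \<squnion> x1) \<sqinter>\<^sub>p (c \<squnion> y \<squnion> x1) \<and>
        ((x \<squnion> x2) \<sqinter>\<^sub>p (c \<squnion> x2)) \<squnion>\<^sub>p y = (x \<squnion> y \<squnion> x2) \<sqinter>\<^sub>p (c \<squnion> y \<squnion> x2))"

definition Abs_c :: "'a::semilattice_sup \<Rightarrow> 'a set \<Rightarrow> 'a set \<Rightarrow> bool" where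
  "Abs_c c I1 I2 \<longleftrightarrow>
     (\<forall>x1\<in>I1. \<forall>y1\<in>I1. \<forall>z2\<in>I2. x1 \<sqinter>\<^sub>p (y1 \<squnion> z2) = x1 \<sqinter>\<^sub>p (y1 \<squnion> c)) \<and>
     (\<forall>x2\<in>I2. \<forall>y2\<in>I2. \<forall>z1\<in>I1. x2 \<sqinter>\<^sub>p (y2 \<squnion> z1) = x2 \<sqinter>\<^sub>p (y2 \<squnion> c))"

definition exi :: "'a::semilattice_sup \<Rightarrow> 'a set \<Rightarrow> 'a set \<Rightarrow> bool" where
  "exi c I1 I2 \<longleftrightarrow> (\<forall>x1\<in>I1. \<forall>x2\<in>I2. \<exists>x. phi c x1 x2 x)"

definition onto_c :: "'a::semilattice_sup \<Rightarrow> 'a set \<Rightarrow> 'a set \<Rightarrow> bool" where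
  "onto_c c I1 I2 \<longleftrightarrow> (\<forall>x. \<exists>x1\<in>I1. \<exists>x2\<in>I2. phi c x1 x2 x)"

text \<open>\<open>direct_sum c I1 I2\<close> is \<open>A = I1 \<oplus>\<^sub>c I2\<close>, where \<open>A\<close> is the whole type.\<close>

definition direct_sum :: "'a::semilattice_sup \<Rightarrow> 'a set \<Rightarrow> 'a set \<Rightarrow> bool" where
  "direct_sum c I1 I2 \<longleftrightarrow>
     subsemilattice I1 \<and> subsemilattice I2 \<and>
     Mod1 c I1 I2 \<and> Mod2 c I1 I2 \<and> Abs_c c I1 I2 \<and> exi c I1 I2 \<and> onto_c c I1 I2"

end

(* For c = \<bottom> each infimum in Mod1, Mod2 and phi is taken of two comparable elements. Hence Mod1, Mod2
   and exi hold in every join-semilattice, phi \<bottom> x1 x2 x just says x1 \<squnion> x2 = x, and direct_sum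
   reduces to Abs and onto. For downward closure, write y \<le> x \<in> I1 as y1 \<squnion> y2; Abs applied to
   y2 \<sqinter> (\<bottom> \<squnion> x) = y2 gives y2 \<le> \<bottom>, so y = y1. *)
theory Submission
  imports Defs
begin

lemma is_infimum_unique: "is_infimum a b m \<Longrightarrow> is_infimum a b n \<Longrightarrow> m = n"
  by (auto simp: is_infimum_def intro: antisym)

lemma pmeet_eq_Some_iff: "a \<sqinter>\<^sub>p b = Some m \<longleftrightarrow> is_infimum a b m"
  by (auto simp: pmeet_def intro: theI dest: is_infimum_unique)

text \<open>Bridge between equations of partial meets and the order:
  \<open>downward_closed_summand\<close> evaluates one meet from right to left and reads off an
  inequality from left to right.\<close>

lemma pmeet_eq_left_iff: "a \<sqinter>\<^sub>p b = Some a \<longleftrightarrow> a \<le> b"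
  by (auto simp: pmeet_eq_Some_iff is_infimum_def)

lemma pmeet_absorb1: "a \<le> b \<Longrightarrow> a \<sqinter>\<^sub>p b = Some a"
  by (simp add: pmeet_eq_left_iff)

lemma pmeet_absorb2: "b \<le> a \<Longrightarrow> a \<sqinter>\<^sub>p b = Some b"
  by (auto simp: pmeet_eq_Some_iff is_infimum_def)

text \<open>The join clause alone forces \<open>x = x1 \<squnion> x2\<close>. Then \<open>x1\<close>
  and \<open>x2\<close> lie below \<open>x\<close>, so (dist) is the meet of \<open>x\<close> with
  itself and (p1), (p2) are meets of \<open>x\<close> with \<open>x1\<close>,
  \<open>x2\<close>.\<close>

lemma phi_bot_iff: "phi \<bottom> x1 x2 x \<longleftrightarrow> x = x1 \<squnion> x2"
  for x :: "'a::bounded_semilattice_sup_bot"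
  by (auto simp: phi_def pmeet_absorb1 pmeet_absorb2 sup.absorb1)

lemma Mod1_bot: "Mod1 \<bottom> I1 I2"
  for I1 I2 :: "'a::bounded_semilattice_sup_bot set"
  unfolding Mod1_def
proof (intro allI ballI impI)
  fix x y x1 x2 :: 'a
  assume "x \<squnion> \<bottom> \<ge> x1 \<squnion> x2"
  \<comment> \<open>Since \<bottom> is neutral, \<open>x\<close> absorbs \<open>x1\<close> and
    \<open>x2\<close>; each meet is then of an element with itself, and both sides become
    \<open>x \<squnion> y\<close>.\<close>
  then have "x1 \<le> x" "x2 \<le> x" by auto
  moreover from this have "x \<squnion> y \<squnion> x1 = x \<squnion> y" "x \<squnion> y \<squnion> x2 = x \<squnion> y"
    by (auto intro: sup.absorb1 le_supI1)
  ultimately show "(x \<squnion> x1) \<sqinter>\<^sub>p (x \<squnion> x2) \<squnion>\<^sub>p y = (x \<squnion> y \<squnion> x1) \<sqinter>\<^sub>p (x \<squnion> y \<squnion> x2)"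
    by (simp add: sup.absorb1 pmeet_absorb1 pjoin_def)
qed

lemma Mod2_bot: "Mod2 \<bottom> I1 I2"
  for I1 I2 :: "'a::bounded_semilattice_sup_bot set"
proof -
  \<comment> \<open>\<open>u\<close> stands for \<open>x1\<close> and for \<open>x2\<close>, so one
    identity serves both conjuncts. The right operand is the smaller one in either meet.\<close>
  have "(x \<squnion> u) \<sqinter>\<^sub>p (\<bottom> \<squnion> u) \<squnion>\<^sub>p y = (x \<squnion> y \<squnion> u) \<sqinter>\<^sub>p (\<bottom> \<squnion> y \<squnion> u)" for x y u :: 'a
  proof -
    have "y \<squnion> u \<le> x \<squnion> y \<squnion> u" by (simp add: sup.assoc)
    then show ?thesis by (simp add: pmeet_absorb2 pjoin_def sup.commute)
  qed
  then show ?thesis by (simp add: Mod2_def)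
qed

lemma direct_sum_bot_iff:
  fixes I1 I2 :: "'a::bounded_semilattice_sup_bot set"
  assumes "subsemilattice I1" and "subsemilattice I2"
  shows "direct_sum \<bottom> I1 I2 \<longleftrightarrow> Abs_c \<bottom> I1 I2 \<and> (\<forall>x. \<exists>x1\<in>I1. \<exists>x2\<in>I2. x = x1 \<squnion> x2)"
  using assms by (simp add: direct_sum_def Mod1_bot Mod2_bot exi_def onto_c_def phi_bot_iff)

text \<open>Only the half of Abs with meets of elements of \<open>I2\<close> enters, so exchanging
  \<open>I1\<close> and \<open>I2\<close> yields the other summand.\<close>

lemma downward_closed_summand:
  fixes I1 I2 :: "'a::bounded_semilattice_sup_bot set"
  assumes Abs: "\<forall>x2\<in>I2. \<forall>y2\<in>I2. \<forall>z1\<in>I1. x2 \<sqinter>\<^sub>p (y2 \<squnion> z1) = x2 \<sqinter>\<^sub>p y2"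
    and onto: "\<forall>x. \<exists>x1\<in>I1. \<exists>x2\<in>I2. x = x1 \<squnion> x2"
  shows "downward_closed I1"
  unfolding downward_closed_def
proof (intro ballI allI impI)
  fix x y assume "x \<in> I1" "y \<le> x"
  obtain y1 y2 where y: "y1 \<in> I1" "y2 \<in> I2" "y = y1 \<squnion> y2" using onto by blast
  \<comment> \<open>Abs needs \<bottom> as an element of \<open>I2\<close>; both components of a
    decomposition of \<bottom> are \<bottom>.\<close>
  obtain b1 b2 where "b2 \<in> I2" "\<bottom> = b1 \<squnion> b2" using onto by blast
  then have "\<bottom> \<in> I2" by (metis sup_eq_bot_iff)
  then have "y2 \<sqinter>\<^sub>p (\<bottom> \<squnion> x) = y2 \<sqinter>\<^sub>p \<bottom>" using Abs \<open>x \<in> I1\<close> y(2) by blast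
  moreover have "y2 \<sqinter>\<^sub>p (\<bottom> \<squnion> x) = Some y2" using \<open>y \<le> x\<close> y(3) by (simp add: pmeet_eq_left_iff)
  ultimately have "y2 \<le> \<bottom>" by (simp add: pmeet_eq_left_iff)
  then show "y \<in> I1" using y by (simp add: bot_unique)
qed

theorem theorem2:
  fixes I1 I2 :: "'a::bounded_semilattice_sup_bot set"
  assumes "subsemilattice I1" and "subsemilattice I2"
  shows "(direct_sum \<bottom> I1 I2 \<longleftrightarrow>
            ((\<forall>x1\<in>I1. \<forall>y1\<in>I1. \<forall>z2\<in>I2. x1 \<sqinter>\<^sub>p (y1 \<squnion> z2) = x1 \<sqinter>\<^sub>p y1) \<and>
             (\<forall>x2\<in>I2. \<forall>y2\<in>I2. \<forall>z1\<in>I1. x2 \<sqinter>\<^sub>p (y2 \<squnion> z1) = x2 \<sqinter>\<^sub>p y2)) \<and>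
            (\<forall>x. \<exists>x1\<in>I1. \<exists>x2\<in>I2. x = x1 \<squnion> x2))
       \<and> (direct_sum \<bottom> I1 I2 \<longrightarrow> downward_closed I1 \<and> downward_closed I2)"
proof -
  have iff: "direct_sum \<bottom> I1 I2 \<longleftrightarrow>
      ((\<forall>x1\<in>I1. \<forall>y1\<in>I1. \<forall>z2\<in>I2. x1 \<sqinter>\<^sub>p (y1 \<squnion> z2) = x1 \<sqinter>\<^sub>p y1) \<and>
       (\<forall>x2\<in>I2. \<forall>y2\<in>I2. \<forall>z1\<in>I1. x2 \<sqinter>\<^sub>p (y2 \<squnion> z1) = x2 \<sqinter>\<^sub>p y2)) \<and>
      (\<forall>x. \<exists>x1\<in>I1. \<exists>x2\<in>I2. x = x1 \<squnion> x2)"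
    using direct_sum_bot_iff[OF assms] by (simp add: Abs_c_def)
  have "downward_closed I1 \<and> downward_closed I2" if ds: "direct_sum \<bottom> I1 I2"
  proof
    \<comment> \<open>The positional instantiation starts with \<open>I2\<close>, which occurs first
      in the premises of the lemma; here it keeps the roles, and \<open>[of I1 I2]\<close> below
      swaps them.\<close>
    show "downward_closed I1" using ds iff by (intro downward_closed_summand[of I2 I1]) auto
    have "\<forall>x. \<exists>x2\<in>I2. \<exists>x1\<in>I1. x = x2 \<squnion> x1" using ds iff by (metis sup.commute)
    then show "downward_closed I2" using ds iff by (intro downward_closed_summand[of I1 I2]) auto
  qed
  with iff show ?thesis by blast
qed

end
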